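(* Let $(V,\langle\cdot,\cdot\rangle)$, $S$, $\Delta$, $f$, $g$ satisfy the standing assumptions (a)–(g) given in the context, with $L$, $S^*$, $f^*$, $G$ as defined there. Let $\epsilon>0$, $\alpha\ge 0$, let $x_1\in S$, and let $N$ be a positive integer such that $$N\ \ge\ \frac{L^2\operatorname{dist}(x_1,S^* )^2}{\epsilon^2}.$$ Let $(x_k,\boldsymbol{\delta}_k,d_k)_{k}$ be generated by the inexact subgradient algorithm described in the context with initial point $x_1$ and error tolerance $\epsilon$, where at each iteration $k$ the point $\boldsymbol{\delta}_k\in\Delta$ is chosen so that $$G(x_k)-g(x_k;\boldsymbol{\delta}_k)\le \alpha\epsilon .$$ Then the set $I_N:=\{k\in\{1,\dots,N\}\mid g(x_k;\boldsymbol{\delta}_k)\le\epsilon\}$ is non-empty, and for a minimizer $k^*$ of $f(x_k)$ over $k\in I_N$, $$f(x_{k^*})\le f^*+\epsilon,\qquad G(x_{k^*})\le (1+\alpha)\epsilon .$$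
   Context: Consider the convex semi-infinite program: minimize $f(x)$ over $x\in V$ subject to $g(x;\boldsymbol{\delta})\le 0$ for all $\boldsymbol{\delta}\in\Delta$ and $x\in S$. Standing assumptions: (a) $V$ is a finite-dimensional real vector space with inner product $\langle\cdot,\cdot\rangle$ and induced norm $\|\cdot\|$. (b) $S$ is a non-empty closed convex subset of $V$. (c) The set $S^*$ of optimal solutions of the program is non-empty. (d) $\Delta$ is a non-empty compact subset of $\mathbb{R}^n$. (e) $f:V\to(-\infty,+\infty]$ is a closed convex function that is subdifferentiable on $S$, and there is a constant $L_f>0$ such that $\|d\|\le L_f$ for all $x\in S$ and $d\in\partial f(x)$. (f) For every $\boldsymbol{\delta}\in\Delta$, $g(\cdot;\boldsymbol{\delta}):V\to(-\infty,+\infty]$ is a closed convex function that is subdifferentiable on $S$, and there is a constant $L_g>0$ such that $\|d\|\le L_g$ for all $x\in S$, $\boldsymbol{\delta}\in\Delta$ and $d\in\partial_x g(x;\boldsymbol{\delta})$. (g) For every $x\in S$, $\Delta\subseteq\operatorname{dom} g(x;\cdot)$ and $g(x;\cdot)$ is continuous on $\Delta$. Put $L:=\max\{L_f,L_g\}$, let $f^*$ be the optimal value of the program, and let $G(x):=\max_{\boldsymbol{\delta}\in\Delta} g(x;\boldsymbol{\delta})$. Notation: $\operatorname{dom} h=\{x\mid h(x)<+\infty\}$. For convex $h:V\to(-\infty,+\infty]$ and $x\in\operatorname{dom}h$, $\partial h(x)=\{d\in V\mid h(y)\ge h(x)+\langle d,y-x\rangle\ \text{for all } y\in V\}$; $\partial_x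 g(x;\boldsymbol{\delta})$ is the subdifferential of $g(\cdot;\boldsymbol{\delta})$ at $x$. A function is subdifferentiable on a set $C$ if its subdifferential is non-empty at every point of $C$. For a non-empty closed convex set $T$, $\operatorname{dist}(x,T)=\min_{y\in T}\|x-y\|$, and $P_T(x)$ is the unique point of $T$ attaining this minimum. Algorithm (input: initial point $x_1\in S$ and error tolerance $\epsilon>0$). For $k=1,2,3,\dots$: find $\boldsymbol{\delta}_k\in\Delta$ that approximately attains $G(x_k)$, i.e., with $g(x_k;\boldsymbol{\delta}_k)\simeq G(x_k)$. (i) If $g(x_k;\boldsymbol{\delta}_k)\le\epsilon$, take $d_k\in\partial f(x_k)$ and let $x_{k+1}:=P_S\left(x_k-\frac{\epsilon}{\|d_k\|^2}d_k\right)$. (ii) Otherwise, namely if $g(x_k;\boldsymbol{\delta}_k)>\epsilon$, take $d_k\in\partial_x g(x_k;\boldsymbol{\delta}_k)$ and let $x_{k+1}:=P_S\left(x_k-\frac{g(x_k;\boldsymbol{\delta}_k)}{\|d_k\|^2}d_k\right)$. *)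

theory Defs
  imports "HOL-Analysis.Analysis"
begin

(* The sort {real_inner, heine_borel} describes the finite-dimensional real inner product
   spaces: by Riesz' theorem a real inner product space has the Heine-Borel property iff its
   dimension is finite. It is the sort of closest_point and, unlike its subclass
   euclidean_space, it admits the zero space. *)

text \<open>Functions into \<open>(-\<infinity>, +\<infinity>]\<close> are \<^typ>\<open>ereal\<close>-valued functions avoiding \<open>-\<infinity>\<close>.\<close>

definition effective_domain :: "('a \<Rightarrow> ereal) \<Rightarrow> 'a set" where
  "effective_domain h = {x. h x < \<infinity>}"

definition ereal_epigraph :: "('a \<Rightarrow> ereal) \<Rightarrow> ('a \<times> real) set" where
  "ereal_epigraph h = {(x, t). h x \<le> ereal t}"

definition closed_convex_function :: "('a::real_normed_vector \<Rightarrow> ereal) \<Rightarrow> bool" where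
  "closed_convex_function h \<longleftrightarrow>
     (\<forall>x. h x \<noteq> -\<infinity>) \<and> convex (ereal_epigraph h) \<and> closed (ereal_epigraph h)"

definition subdifferential :: "('a::real_inner \<Rightarrow> ereal) \<Rightarrow> 'a \<Rightarrow> 'a set" where
  "subdifferential h x =
     {d. x \<in> effective_domain h \<and> (\<forall>y. h y \<ge> h x + ereal (d \<bullet> (y - x)))}"

definition subdifferentiable_on :: "('a::real_inner \<Rightarrow> ereal) \<Rightarrow> 'a set \<Rightarrow> bool" where
  "subdifferentiable_on h C \<longleftrightarrow> (\<forall>x\<in>C. subdifferential h x \<noteq> {})"

text \<open>
  The convex semi-infinite program: minimize \<open>f x\<close> subject to \<open>x \<in> S\<close> and
  \<open>g x \<delta> \<le> 0\<close> for all \<open>\<delta> \<in> \<Delta>\<close>.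
\<close>

definition feasible_set :: "'a set \<Rightarrow> 'b set \<Rightarrow> ('a \<Rightarrow> 'b \<Rightarrow> ereal) \<Rightarrow> 'a set" where
  "feasible_set S \<Delta> g = {x \<in> S. \<forall>\<delta>\<in>\<Delta>. g x \<delta> \<le> 0}"

definition optimal_value ::
  "'a set \<Rightarrow> 'b set \<Rightarrow> ('a \<Rightarrow> ereal) \<Rightarrow> ('a \<Rightarrow> 'b \<Rightarrow> ereal) \<Rightarrow> ereal" where
  "optimal_value S \<Delta> f g = (INF x\<in>feasible_set S \<Delta> g. f x)"

definition optimal_solutions ::
  "'a set \<Rightarrow> 'b set \<Rightarrow> ('a \<Rightarrow> ereal) \<Rightarrow> ('a \<Rightarrow> 'b \<Rightarrow> ereal) \<Rightarrow> 'a set" where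
  "optimal_solutions S \<Delta> f g =
     {x \<in> feasible_set S \<Delta> g. \<forall>y\<in>feasible_set S \<Delta> g. f x \<le> f y}"

(* The supremum is a maximum for x in S, where g x is continuous on the non-empty compact
   set Delta. *)
definition max_constraint :: "'b set \<Rightarrow> ('a \<Rightarrow> 'b \<Rightarrow> ereal) \<Rightarrow> 'a \<Rightarrow> ereal" where
  "max_constraint \<Delta> g x = (SUP \<delta>\<in>\<Delta>. g x \<delta>)"

text \<open>
  Iterates are indexed from 1; index 0 plays no role. The accuracy with which \<open>\<delta> k\<close>
  attains the maximum of \<open>g (x k)\<close> is not part of this definition.

  The step length divides by \<open>(norm (d k))\<^sup>2\<close>. If \<open>d k = 0\<close>, the convention
  \<open>r / 0 = 0\<close> makes the iterate stay where it is. Under the assumptions on the program this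
  can only happen in the first case, when \<open>x k\<close> minimizes \<open>f\<close> over the whole space: in
  the second case \<open>g (x k) (\<delta> k) > \<epsilon>\<close>, while \<open>g _ (\<delta> k)\<close> takes a nonpositive value at
  every feasible point.
\<close>

definition inexact_subgradient_sequence ::
  "'a::{real_inner, heine_borel} set \<Rightarrow> 'b set \<Rightarrow> ('a \<Rightarrow> ereal) \<Rightarrow> ('a \<Rightarrow> 'b \<Rightarrow> ereal) \<Rightarrow>
   'a \<Rightarrow> real \<Rightarrow> (nat \<Rightarrow> 'a) \<Rightarrow> (nat \<Rightarrow> 'b) \<Rightarrow> (nat \<Rightarrow> 'a) \<Rightarrow> bool" where
  "inexact_subgradient_sequence S \<Delta> f g x1 \<epsilon> x \<delta> d \<longleftrightarrow>
     x 1 = x1 \<and>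
     (\<forall>k\<ge>1. \<delta> k \<in> \<Delta> \<and>
       (if g (x k) (\<delta> k) \<le> ereal \<epsilon>
        then d k \<in> subdifferential f (x k) \<and>
             x (k + 1) = closest_point S (x k - (\<epsilon> / (norm (d k))\<^sup>2) *\<^sub>R d k)
        else d k \<in> subdifferential (\<lambda>y. g y (\<delta> k)) (x k) \<and>
             x (k + 1) =
               closest_point S (x k - (real_of_ereal (g (x k) (\<delta> k)) / (norm (d k))\<^sup>2) *\<^sub>R d k)))"

end

(* Let y be an optimal solution nearest to x1. As long as an iterate is infeasible by more than
   epsilon, or is epsilon-feasible with f-value above the optimal value plus epsilon, the
   subgradient inequality at y makes the projected step decrease the squared distance to y by
   more than epsilon^2 / L^2. This cannot happen at each of the first N steps. *)

theory Submission
  imports Defs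
begin

text \<open>The subgradient inequality carried over to the reals. It asks only for an upper bound
  \<open>b\<close> on \<open>h y\<close>, so that one rule serves both the objective, with the
  optimal value as \<open>b\<close>, and a constraint at a feasible point, with
  \<open>b = 0\<close>.\<close>

lemma subdifferential_inner_ge:
  assumes "v \<in> subdifferential h z" "h z = ereal a" "h y \<le> ereal b"
  shows "a - b \<le> v \<bullet> (z - y)"
proof -
  have "ereal (a + v \<bullet> (y - z)) \<le> h y"
    using assms(1,2) by (auto simp: subdifferential_def)
  with assms(3) have "ereal (a + v \<bullet> (y - z)) \<le> ereal b"
    by (rule order_trans[rotated])
  then show ?thesis
    by (simp add: inner_diff_right)
qed

text \<open>Slicing the closed epigraph at height \<open>t\<close> is taking its preimage under a
  continuous map.\<close>

lemma closed_sublevel: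
  assumes "closed_convex_function h"
  shows "closed {x. h x \<le> ereal t}"
proof -
  have "closed ((\<lambda>x. (x, t)) -` ereal_epigraph h)"
    using assms
    by (intro continuous_closed_vimage) (auto simp: closed_convex_function_def)
  also have "(\<lambda>x. (x, t)) -` ereal_epigraph h = {x. h x \<le> ereal t}"
    by (auto simp: ereal_epigraph_def)
  finally show ?thesis .
qed

lemma optimal_value_eq:
  assumes "y \<in> optimal_solutions S \<Delta> f g"
  shows "optimal_value S \<Delta> f g = f y"
  using assms unfolding optimal_value_def optimal_solutions_def
  by (intro antisym INF_lower INF_greatest) auto

text \<open>One optimal solution of finite value \<open>c\<close> turns optimality into
  \<open>f x \<le> c\<close>, which leaves an intersection of \<open>S\<close> with sublevel sets.
  Closedness lets the distance to the optimal set be attained.\<close>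

lemma closed_optimal_solutions:
  assumes "closed S" "closed_convex_function f"
    and "\<And>\<eta>. \<eta> \<in> \<Delta> \<Longrightarrow> closed_convex_function (\<lambda>y. g y \<eta>)"
    and y: "y \<in> optimal_solutions S \<Delta> f g" "f y = ereal c"
  shows "closed (optimal_solutions S \<Delta> f g)"
proof -
  have "optimal_solutions S \<Delta> f g =
      S \<inter> {x. f x \<le> ereal c} \<inter> (\<Inter>\<eta>\<in>\<Delta>. {x. g x \<eta> \<le> ereal 0})"
    using y by (force simp: optimal_solutions_def feasible_set_def zero_ereal_def)
  also have "closed \<dots>"
    using assms(1-3) by (intro closed_Int closed_INT ballI closed_sublevel) auto
  finally show ?thesis .
qed

text \<open>Projection onto \<open>S\<close> is nonexpansive and fixes \<open>y\<close>, so it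
  suffices to expand the square for the unprojected step. The numerator \<open>r\<close> is kept
  apart from \<open>e\<close> to cover both kinds of step: \<open>r = e\<close> for the objective,
  \<open>r\<close> the violated constraint value otherwise.\<close>

lemma projected_step_decrease:
  fixes S :: "'a::{real_inner, heine_borel} set"
  assumes S: "closed S" "convex S" "y \<in> S"
    and r: "0 < e" "e \<le> r" "r \<le> v \<bullet> (z - y)" "e < v \<bullet> (z - y)"
    and v: "norm v \<le> L"
  shows "(norm (closest_point S (z - (r / (norm v)\<^sup>2) *\<^sub>R v) - y))\<^sup>2
    < (norm (z - y))\<^sup>2 - e\<^sup>2 / L\<^sup>2"
proof -
  define a where "a = v \<bullet> (z - y)"
  define s where "s = r / (norm v)\<^sup>2"
  \<comment> \<open>The inner product of \<open>v\<close> with \<open>z - y\<close> is positive, so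
    the convention \<open>r / 0 = 0\<close> never comes into play.\<close>
  have "v \<noteq> 0"
    using r by auto
  then have nv: "norm v > 0"
    by simp
  have "norm (closest_point S (z - s *\<^sub>R v) - y) \<le> norm (z - s *\<^sub>R v - y)"
    using closest_point_lipschitz[of S "z - s *\<^sub>R v" y] S
    by (auto simp: closest_point_self dist_norm)
  then have "(norm (closest_point S (z - s *\<^sub>R v) - y))\<^sup>2 \<le> (norm (z - s *\<^sub>R v - y))\<^sup>2"
    by (simp add: power_mono)
  also have "\<dots> = (norm ((z - y) - s *\<^sub>R v))\<^sup>2"
    by (simp add: algebra_simps)
  also have "\<dots> = (norm (z - y))\<^sup>2 - 2 * s * a + s\<^sup>2 * (norm v)\<^sup>2"
    unfolding a_def power2_norm_eq_inner
    by (simp add: inner_diff_left inner_diff_right inner_commute power2_eq_square algebra_simps)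
  also have "\<dots> = (norm (z - y))\<^sup>2 - (2 * r * a - r\<^sup>2) / (norm v)\<^sup>2"
    using nv by (simp add: s_def field_simps power2_eq_square)
  also have "\<dots> < (norm (z - y))\<^sup>2 - e\<^sup>2 / (norm v)\<^sup>2"
  proof -
    \<comment> \<open>Split \<open>2 * r * a - r\<^sup>2\<close> as
      \<open>r * a + r * (a - r)\<close>: the second term is nonnegative by
      \<open>r \<le> a\<close>, and the first exceeds \<open>e * e\<close>. The strictness comes
      from \<open>e < a\<close>.\<close>
    have "e * e < e * a"
      using r by (simp add: a_def)
    also have "\<dots> \<le> r * a"
      using r by (intro mult_right_mono) (auto simp: a_def)
    also have "\<dots> \<le> r * a + r * (a - r)"
      using r by (simp add: a_def)
    finally have "e\<^sup>2 < 2 * r * a - r\<^sup>2"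
      by (simp add: power2_eq_square algebra_simps)
    then show ?thesis
      using nv by (simp add: divide_strict_right_mono)
  qed
  also have "\<dots> \<le> (norm (z - y))\<^sup>2 - e\<^sup>2 / L\<^sup>2"
    using nv v less_le_trans[OF nv v]
    by (intro diff_left_mono divide_left_mono power_mono mult_pos_pos zero_less_power) auto
  finally show ?thesis
    by (simp add: s_def)
qed

theorem theorem3p4:
  fixes S :: "'a::{real_inner, heine_borel} set"
    and \<Delta> :: "(real ^ 'n) set"
    and f :: "'a \<Rightarrow> ereal"
    and g :: "'a \<Rightarrow> real ^ 'n \<Rightarrow> ereal"
    and L\<^sub>f L\<^sub>g \<epsilon> \<alpha> :: real
    and x1 :: 'a
    and N :: nat
    and x d :: "nat \<Rightarrow> 'a"
    and \<delta> :: "nat \<Rightarrow> real ^ 'n"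
  defines "L \<equiv> max L\<^sub>f L\<^sub>g"
    and "S_opt \<equiv> optimal_solutions S \<Delta> f g"
    and "f_opt \<equiv> optimal_value S \<Delta> f g"
    and "G \<equiv> max_constraint \<Delta> g"
    and "I \<equiv> {k \<in> {1..N}. g (x k) (\<delta> k) \<le> ereal \<epsilon>}"
  assumes S: "S \<noteq> {}" "closed S" "convex S"
    and S_opt: "S_opt \<noteq> {}"
    and Delta: "\<Delta> \<noteq> {}" "compact \<Delta>"
    and f: "closed_convex_function f" "subdifferentiable_on f S"
    and L_f: "L\<^sub>f > 0" "\<And>y v. y \<in> S \<Longrightarrow> v \<in> subdifferential f y \<Longrightarrow> norm v \<le> L\<^sub>f"
    and g: "\<And>\<eta>. \<eta> \<in> \<Delta> \<Longrightarrow> closed_convex_function (\<lambda>y. g y \<eta>)"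
      "\<And>\<eta>. \<eta> \<in> \<Delta> \<Longrightarrow> subdifferentiable_on (\<lambda>y. g y \<eta>) S"
    and L_g: "L\<^sub>g > 0"
      "\<And>y \<eta> v. y \<in> S \<Longrightarrow> \<eta> \<in> \<Delta> \<Longrightarrow> v \<in> subdifferential (\<lambda>z. g z \<eta>) y \<Longrightarrow> norm v \<le> L\<^sub>g"
    and g_cont: "\<And>y. y \<in> S \<Longrightarrow> \<Delta> \<subseteq> effective_domain (g y)"
      "\<And>y. y \<in> S \<Longrightarrow> continuous_on \<Delta> (g y)"
    and params: "\<epsilon> > 0" "\<alpha> \<ge> 0" "x1 \<in> S"
    and N: "N \<ge> 1" "real N \<ge> L\<^sup>2 * (infdist x1 S_opt)\<^sup>2 / \<epsilon>\<^sup>2"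
    and run: "inexact_subgradient_sequence S \<Delta> f g x1 \<epsilon> x \<delta> d"
    and inexact: "\<And>k. k \<ge> 1 \<Longrightarrow> G (x k) - g (x k) (\<delta> k) \<le> ereal (\<alpha> * \<epsilon>)"
  shows "I \<noteq> {} \<and>
    (\<forall>k\<in>I. (\<forall>j\<in>I. f (x k) \<le> f (x j)) \<longrightarrow>
      f (x k) \<le> f_opt + ereal \<epsilon> \<and> G (x k) \<le> ereal ((1 + \<alpha>) * \<epsilon>))"
proof -
  have L: "L > 0" "L\<^sub>f \<le> L" "L\<^sub>g \<le> L"
    using L_f(1) by (auto simp: L_def)
  have f_fin: "\<exists>c. f z = ereal c" if "z \<in> S" for z
  proof -
    have "f z < \<infinity>"
      using f(2) that
      by (auto simp: subdifferentiable_on_def subdifferential_def effective_domain_def)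
    moreover have "f z \<noteq> -\<infinity>"
      using f(1) by (simp add: closed_convex_function_def)
    ultimately show ?thesis
      by (cases "f z") auto
  qed
  have g_fin: "\<exists>c. g z \<eta> = ereal c" if "z \<in> S" "\<eta> \<in> \<Delta>" for z \<eta>
  proof -
    have "g z \<eta> < \<infinity>"
      using g_cont(1) that by (auto simp: effective_domain_def)
    moreover have "g z \<eta> \<noteq> -\<infinity>"
      using g(1) that(2) by (simp add: closed_convex_function_def)
    ultimately show ?thesis
      by (cases "g z \<eta>") auto
  qed
  have in_S: "z \<in> S" if "z \<in> S_opt" for z
    using that by (simp add: S_opt_def optimal_solutions_def feasible_set_def)
  \<comment> \<open>An arbitrary optimum, used only to supply the real level for the closedness of
    \<open>S_opt\<close>.\<close>
  obtain y0 c0 where "y0 \<in> S_opt" "f y0 = ereal c0"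
    using S_opt f_fin in_S by blast
  then have "closed S_opt"
    unfolding S_opt_def using closed_optimal_solutions S(2) f(1) g(1) by blast
  \<comment> \<open>This \<open>y\<close> stays fixed as the reference point for all
    iterations.\<close>
  then obtain y where y: "y \<in> S_opt" "infdist x1 S_opt = dist x1 y"
    using infdist_attains_inf S_opt by blast
  have yS: "y \<in> S"
    using y(1) in_S by simp
  have gy: "g y \<eta> \<le> ereal 0" if "\<eta> \<in> \<Delta>" for \<eta>
    using y(1) that by (simp add: S_opt_def optimal_solutions_def feasible_set_def zero_ereal_def)
  obtain c where c: "f y = ereal c"
    using f_fin yS by blast
  have f_opt: "f_opt = ereal c"
    using optimal_value_eq[of y S \<Delta> f g] y(1) c by (simp add: f_opt_def S_opt_def)
  have x_1: "x 1 = x1" and \<delta>: "\<And>k. k \<ge> 1 \<Longrightarrow> \<delta> k \<in> \<Delta>"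
    using run by (auto simp: inexact_subgradient_sequence_def)
  have step_i: "d k \<in> subdifferential f (x k)"
      "x (k + 1) = closest_point S (x k - (\<epsilon> / (norm (d k))\<^sup>2) *\<^sub>R d k)"
    if "k \<ge> 1" "g (x k) (\<delta> k) \<le> ereal \<epsilon>" for k
    using run that by (auto simp: inexact_subgradient_sequence_def)
  have step_ii: "d k \<in> subdifferential (\<lambda>y. g y (\<delta> k)) (x k)"
      "x (k + 1) =
        closest_point S (x k - (real_of_ereal (g (x k) (\<delta> k)) / (norm (d k))\<^sup>2) *\<^sub>R d k)"
    if "k \<ge> 1" "\<not> g (x k) (\<delta> k) \<le> ereal \<epsilon>" for k
    using run that unfolding inexact_subgradient_sequence_def by presburger+
  have xS: "x k \<in> S" if "k \<ge> 1" for k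
    using that
  proof (induction k rule: dec_induct)
    case base
    then show ?case
      using x_1 params(3) by simp
  next
    case (step k)
    then show ?case
      using step_i(2)[of k] step_ii(2)[of k] closest_point_in_set[OF S(2) S(1)]
      by (cases "g (x k) (\<delta> k) \<le> ereal \<epsilon>") auto
  qed
  \<comment> \<open>The premise \<open>bad\<close> restricts only objective steps; a constraint step
    always makes progress towards \<open>y\<close>.\<close>
  have decrease: "(norm (x (k + 1) - y))\<^sup>2 < (norm (x k - y))\<^sup>2 - \<epsilon>\<^sup>2 / L\<^sup>2"
    if k: "k \<ge> 1"
      and bad: "g (x k) (\<delta> k) \<le> ereal \<epsilon> \<Longrightarrow> \<not> f (x k) \<le> f_opt + ereal \<epsilon>" for k
  proof (cases "g (x k) (\<delta> k) \<le> ereal \<epsilon>")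
    case True
    obtain a where a: "f (x k) = ereal a"
      using f_fin xS k by blast
    have "a - c \<le> d k \<bullet> (x k - y)"
      using subdifferential_inner_ge step_i(1)[OF k True] a c by (metis order_refl)
    moreover have "c + \<epsilon> < a"
      using bad[OF True] by (simp add: a f_opt)
    ultimately show ?thesis
      unfolding step_i(2)[OF k True]
      using L_f(2)[OF xS[OF k] step_i(1)[OF k True]] L params(1)
      by (intro projected_step_decrease S yS) auto
  next
    case False
    obtain a where a: "g (x k) (\<delta> k) = ereal a"
      using g_fin xS \<delta> k by blast
    \<comment> \<open>Feasibility of \<open>y\<close> supplies the bound \<open>0\<close>, so the
      product is at least the numerator \<open>a\<close> of the step.\<close>
    have "a - 0 \<le> d k \<bullet> (x k - y)"
      using subdifferential_inner_ge[OF step_ii(1)[OF k False]] a gy[OF \<delta>[OF k]] .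
    moreover have "\<epsilon> < a"
      using False by (simp add: a)
    ultimately show ?thesis
      unfolding step_ii(2)[OF k False]
      using L_g(2)[OF xS[OF k] \<delta>[OF k] step_ii(1)[OF k False]] L params(1)
      by (intro projected_step_decrease S yS) (auto simp: a)
  qed
  \<comment> \<open>Gives at once that \<open>I\<close> is non-empty and that some index in it is
    nearly optimal.\<close>
  have good: "\<exists>k\<in>I. f (x k) \<le> f_opt + ereal \<epsilon>"
  proof (rule ccontr)
    assume "\<not> ?thesis"
    then have bad: "(norm (x (k + 1) - y))\<^sup>2 < (norm (x k - y))\<^sup>2 - \<epsilon>\<^sup>2 / L\<^sup>2"
      if "k \<in> {1..N}" for k
      using that by (intro decrease) (auto simp: I_def)
    \<comment> \<open>The induction starts at \<open>m = 1\<close> because the strict inequality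
      fails for \<open>m = 0\<close>. Strictness is essential: the bound on \<open>N\<close> may
      hold with equality.\<close>
    have "(norm (x (m + 1) - y))\<^sup>2 < (norm (x 1 - y))\<^sup>2 - real m * (\<epsilon>\<^sup>2 / L\<^sup>2)"
      if "1 \<le> m" "m \<le> N" for m
      using that
    proof (induction m rule: dec_induct)
      case base
      then show ?case
        using bad[of 1] by simp
    next
      case (step m)
      then show ?case
        using bad[of "Suc m"] by (simp add: distrib_right add_divide_distrib)
    qed
    from this[of N] have "real N * (\<epsilon>\<^sup>2 / L\<^sup>2) < (norm (x1 - y))\<^sup>2"
      using N(1) zero_le_power2[of "norm (x (N + 1) - y)"] unfolding x_1 by linarith
    moreover have "(norm (x1 - y))\<^sup>2 \<le> real N * (\<epsilon>\<^sup>2 / L\<^sup>2)"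
      using N(2) L(1) params(1) by (simp add: y(2) dist_norm field_simps)
    ultimately show False
      by simp
  qed
  \<comment> \<open>Add the inexactness bound to
    \<open>g (x k) (\<delta> k) \<le> \<epsilon>\<close>; this works at every index of
    \<open>I\<close>. Finiteness of the constraint value makes the \<open>ereal\<close> subtraction
    reversible.\<close>
  have "G (x k) \<le> ereal ((1 + \<alpha>) * \<epsilon>)" if "k \<in> I" for k
  proof -
    have k: "k \<ge> 1" "g (x k) (\<delta> k) \<le> ereal \<epsilon>"
      using that by (auto simp: I_def)
    then obtain a where a: "g (x k) (\<delta> k) = ereal a"
      using g_fin xS \<delta> by blast
    show ?thesis
      using inexact[OF k(1)] k(2) unfolding a
      by (cases "G (x k)") (auto simp: algebra_simps)
  qed
  \<comment> \<open>A minimizer over \<open>I\<close> does no worse in \<open>f\<close> than the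
    index from \<open>good\<close>.\<close>
  then show ?thesis
    using good by (auto intro: order_trans)
qed

end
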